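(* Let $k\in\mathbb{R}$ and let $G$ be the simply connected 4-dimensional Lie group whose Lie algebra has a basis $X_1,X_2,X_3,X_4$ with $$[X_2,X_3]=[X_3,X_1]=[X_1,X_2]=0,\quad [X_1,X_4]=kX_1+X_2,\quad [X_2,X_4]=-X_1+kX_2,\quad [X_3,X_4]=-2kX_3 .$$ For real numbers $a_1,\dots,a_6$ let $$Y_1=X_1+a_2X_2+a_3X_3,\quad Y_2=X_2+a_1X_3,\quad Y_3=X_3,\quad Y_4=a_4X_1+a_5X_2+a_6X_3+X_4 .$$ Suppose the left-invariant metric $g_0$ on $G$ is diagonal in the basis $Y_i$, i.e. $g_0(Y_i,Y_j)=\lambda_i\delta_{ij}$ with $\lambda_i>0$. Then the Ricci flow solution $g(t)$ with $g(0)=g_0$ remains diagonal in the basis $Y_i$ if and only if $a_1=a_2=a_3=0$.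
   Context: Elements of the Lie algebra are identified with left-invariant vector fields on $G$. The Ricci flow solution $g(t)$ is the left-invariant solution of $\frac{\partial}{\partial t}g(t)=-2\operatorname{Ric}(g(t))$, $g(0)=g_0$ (equivalently, the solution of the corresponding ODE on inner products on the Lie algebra). "$g(t)$ remains diagonal in the basis $Y_i$" means $g(t)(Y_i,Y_j)=0$ for all $i\ne j$ and all $t\ge0$ in its maximal interval of existence. *)

theory Defs
  imports "HOL-Analysis.Analysis"
begin

text \<open>
  A simply connected Lie group is determined by its Lie algebra, the space of left-invariant
  vector fields; left-invariant tensor fields on the group are multilinear maps on it.  In
  particular left-invariant Riemannian metrics are inner products, and all functions
  \<open>g (u, v)\<close> of left-invariant fields \<open>u\<close>, \<open>v\<close> are constant on the group.
\<close>

definition lie_algebra :: "('g::real_vector \<Rightarrow> 'g \<Rightarrow> 'g) \<Rightarrow> bool" where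
  "lie_algebra br \<longleftrightarrow>
     bilinear br \<and>
     (\<forall>x. br x x = 0) \<and>
     (\<forall>x y z. br x (br y z) + br y (br z x) + br z (br x y) = 0)"

definition inner_product :: "('g::real_vector \<Rightarrow> 'g \<Rightarrow> real) \<Rightarrow> bool" where
  "inner_product g \<longleftrightarrow>
     bilinear g \<and> (\<forall>x y. g x y = g y x) \<and> (\<forall>x. x \<noteq> 0 \<longrightarrow> g x x > 0)"

definition is_basis :: "'g::real_vector set \<Rightarrow> bool" where
  "is_basis B \<longleftrightarrow> independent B \<and> span B = UNIV"

text \<open>Trace of an endomorphism of a finite-dimensional space; independent of the basis chosen.\<close>

definition endo_trace :: "('g::real_vector \<Rightarrow> 'g) \<Rightarrow> real" where
  "endo_trace f = (let B = (SOME B. is_basis B) in \<Sum>b\<in>B. representation B (f b) b)"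

text \<open>
  The Levi-Civita connection \<open>D u v\<close> (derivative of \<open>v\<close> in direction \<open>u\<close>) on left-invariant
  fields: torsion-free and metric.  The term \<open>u (g (v, w))\<close> in the metric condition vanishes,
  since \<open>g (v, w)\<close> is constant.
\<close>

definition levi_civita ::
  "('g::real_vector \<Rightarrow> 'g \<Rightarrow> 'g) \<Rightarrow> ('g \<Rightarrow> 'g \<Rightarrow> real) \<Rightarrow> 'g \<Rightarrow> 'g \<Rightarrow> 'g" where
  "levi_civita br g = (THE D.
     bilinear D \<and>
     (\<forall>u v. D u v - D v u = br u v) \<and>
     (\<forall>u v w. g (D u v) w + g v (D u w) = 0))"

definition riemann ::
  "('g::real_vector \<Rightarrow> 'g \<Rightarrow> 'g) \<Rightarrow> ('g \<Rightarrow> 'g \<Rightarrow> real) \<Rightarrow> 'g \<Rightarrow> 'g \<Rightarrow> 'g \<Rightarrow> 'g" where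
  "riemann br g u v w = (let D = levi_civita br g in
     D u (D v w) - D v (D u w) - D (br u v) w)"

text \<open>Signs are such that round spheres have positive Ricci curvature.\<close>

definition ricci ::
  "('g::real_vector \<Rightarrow> 'g \<Rightarrow> 'g) \<Rightarrow> ('g \<Rightarrow> 'g \<Rightarrow> real) \<Rightarrow> 'g \<Rightarrow> 'g \<Rightarrow> real" where
  "ricci br g v w = endo_trace (\<lambda>u. riemann br g u v w)"

text \<open>The forward time interval \<open>[0, T)\<close> with \<open>T\<close> possibly infinite.\<close>

definition forward_interval :: "ereal \<Rightarrow> real set" where
  "forward_interval T = {t. 0 \<le> t \<and> ereal t < T}"

definition ricci_flow ::
  "('g::real_vector \<Rightarrow> 'g \<Rightarrow> 'g) \<Rightarrow> ('g \<Rightarrow> 'g \<Rightarrow> real) \<Rightarrow> ereal \<Rightarrow>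
   (real \<Rightarrow> 'g \<Rightarrow> 'g \<Rightarrow> real) \<Rightarrow> bool" where
  "ricci_flow br g0 T g \<longleftrightarrow>
     0 < T \<and> g 0 = g0 \<and>
     (\<forall>t\<in>forward_interval T. inner_product (g t) \<and>
        (\<forall>u v. ((\<lambda>s. g s u v) has_real_derivative - 2 * ricci br (g t) u v)
                 (at t within forward_interval T)))"

definition maximal_ricci_flow ::
  "('g::real_vector \<Rightarrow> 'g \<Rightarrow> 'g) \<Rightarrow> ('g \<Rightarrow> 'g \<Rightarrow> real) \<Rightarrow> ereal \<Rightarrow>
   (real \<Rightarrow> 'g \<Rightarrow> 'g \<Rightarrow> real) \<Rightarrow> bool" where
  "maximal_ricci_flow br g0 T g \<longleftrightarrow>
     ricci_flow br g0 T g \<and>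
     (\<forall>T' g'. ricci_flow br g0 T' g' \<and> (\<forall>t\<in>forward_interval T. g' t = g t) \<longrightarrow> T' \<le> T)"

end

theory Submission
  imports Defs
begin

text \<open>
  The fields \<open>X 1\<close>, \<open>X 2\<close>, \<open>X 3\<close> span an abelian ideal on which \<open>X 4\<close> acts without trace.  For a
  metric that is diagonal in a frame \<open>Y 1, \<dots>, Y 4\<close> of the given shape with squared lengths \<open>q i\<close>,
  if \<open>m\<close> is the matrix of the action in that frame, then
  \<open>2 q\<^sub>4 Ric(Y\<^sub>a, Y\<^sub>b) = \<Sum>\<^sub>j (m\<^sub>a\<^sub>j m\<^sub>b\<^sub>j q\<^sub>a q\<^sub>b / q\<^sub>j - m\<^sub>j\<^sub>a m\<^sub>j\<^sub>b q\<^sub>j)\<close> and \<open>Ric(Y\<^sub>a, Y\<^sub>4) = 0\<close>.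

  If the flow stays diagonal, the off-diagonal Ricci components vanish at time \<open>0\<close>, and this is
  an algebraic system in \<open>a1\<close>, \<open>a2\<close>, \<open>a3\<close> whose only solution is \<open>0\<close>.  Conversely, every inner
  product is diagonal in its own Gram--Schmidt frame.  In terms of these frames, the off-diagonal
  components of the metric in the initial frame satisfy a differential equation whose right-hand
  side is bounded, on compact time intervals, by a multiple of these components; by Gronwall they
  vanish identically if they vanish initially.
\<close>

section \<open>Inner products, orthogonal frames and traces\<close>

lemma inner_productD:
  assumes "inner_product g"
  shows "bilinear g" "g x y = g y x" "x \<noteq> 0 \<Longrightarrow> g x x > 0"
  using assms unfolding inner_product_def by blast+

lemma bilinear_lincomb_left:
  fixes h :: "'a::real_vector \<Rightarrow> 'b::real_vector \<Rightarrow> real"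
  assumes "bilinear h"
  shows "h (\<Sum>i\<in>I. c i *\<^sub>R e i) y = (\<Sum>i\<in>I. c i * h (e i) y)"
proof -
  interpret linear "\<lambda>x. h x y" using assms by (simp add: bilinear_def)
  show ?thesis by (simp add: sum scale)
qed

lemma inner_product_eqI:
  assumes "inner_product g" "\<And>w. g u w = g v w"
  shows "u = v"
proof -
  have "g (u - v) (u - v) = 0"
    using assms(2) by (simp add: bilinear_lsub[OF inner_productD(1)[OF assms(1)]])
  then show ?thesis using inner_productD(3)[OF assms(1), of "u - v"] by fastforce
qed

text \<open>The frame is orthogonal but not normalised: unit vectors would bring in square roots and
  destroy the unipotent shape of the frame \<open>Y\<close>. Squared lengths therefore appear as
  denominators throughout.\<close>

locale orthogonal_frame =
  fixes g :: "'g::real_vector \<Rightarrow> 'g \<Rightarrow> real" and I :: "'i set" and e :: "'i \<Rightarrow> 'g"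
  assumes inner: "inner_product g"
    and finite_index: "finite I"
    and orthogonal: "\<And>i j. \<lbrakk>i \<in> I; j \<in> I; i \<noteq> j\<rbrakk> \<Longrightarrow> g (e i) (e j) = 0"
    and nonzero: "\<And>i. i \<in> I \<Longrightarrow> e i \<noteq> 0"
    and spans: "span (e ` I) = UNIV"
begin

lemmas bil = inner_productD(1)[OF inner]
lemmas sym = inner_productD(2)[OF inner]
lemmas pos = inner_productD(3)[OF inner]

lemmas bil_simps = bilinear_ladd[OF bil] bilinear_radd[OF bil] bilinear_lsub[OF bil]
  bilinear_rsub[OF bil] bilinear_lmul[OF bil] bilinear_rmul[OF bil]
  bilinear_lneg[OF bil] bilinear_rneg[OF bil] bilinear_lzero[OF bil] bilinear_rzero[OF bil]

lemma norm_pos: "i \<in> I \<Longrightarrow> g (e i) (e i) > 0"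
  using pos nonzero by blast

text \<open>Both sides are linear in \<open>v\<close>; by orthogonality they agree on the frame,
  which spans.\<close>

lemma expansion: "(\<Sum>i\<in>I. (g v (e i) / g (e i) (e i)) *\<^sub>R e i) = v"
proof -
  let ?p = "\<lambda>v. \<Sum>i\<in>I. (g v (e i) / g (e i) (e i)) *\<^sub>R e i"
  have "linear ?p"
    by (rule linearI)
      (simp_all add: bil_simps add_divide_distrib scaleR_add_left sum.distrib scaleR_sum_right)
  moreover have "linear (\<lambda>v::'g. v)" by (rule linearI) auto
  moreover have "?p b = b" if b: "b \<in> e ` I" for b
  proof -
    obtain j where j: "j \<in> I" "b = e j" using b by blast
    have "?p b = (\<Sum>i\<in>I. if i = j then e j else 0)"
      using j orthogonal norm_pos[of j] by (intro sum.cong) auto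
    then show ?thesis using j finite_index by simp
  qed
  moreover have "v \<in> span (e ` I)" using spans by simp
  ultimately show ?thesis
    using linear_eq_on[of ?p "\<lambda>v. v" v "e ` I"] by blast
qed

lemma frame_eqI:
  assumes "\<And>i. i \<in> I \<Longrightarrow> g u (e i) = g v (e i)"
  shows "u = v"
  using expansion[of u] expansion[of v] assms by (metis (no_types, lifting) sum.cong)

lemma exists_basis: "\<exists>B::'g set. is_basis B"
  unfolding is_basis_def
  using maximal_independent_subset[of "UNIV::'g set"] by (metis top.extremum_uniqueI)

text \<open>Expanding every \<open>b\<close> of the chosen basis in the frame turns the trace into a
  double sum. After the sums are swapped, the sum over the basis reassembles \<open>f (e i)\<close>,
  and the choice of basis disappears.\<close>

lemma endo_trace_frame:
  assumes "linear f"
  shows "endo_trace f = (\<Sum>i\<in>I. g (f (e i)) (e i) / g (e i) (e i))"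
proof -
  define B :: "'g set" where "B = (SOME B. is_basis B)"
  have "is_basis B" unfolding B_def using someI_ex[OF exists_basis] .
  then have B: "independent B" "span B = UNIV" by (auto simp: is_basis_def)
  \<comment> \<open>An independent set inside the span of a finite frame is finite, so the sum that
    defines the trace is a genuine one.\<close>
  have "finite B"
    using independent_span_bound[of "e ` I" B] finite_index B(1) spans by simp
  interpret f: linear f by fact
  have rep: "linear (\<lambda>v. representation B v b)" for b
    by (rule linearI) (simp_all add: B real_vector.representation_add real_vector.representation_scale)
  have "representation B (f b) b
      = (\<Sum>i\<in>I. (g b (e i) / g (e i) (e i)) * representation B (f (e i)) b)" for b
  proof -
    interpret r: linear "\<lambda>v. representation B v b" by (rule rep)
    have "representation B (f b) b
      = representation B (f (\<Sum>i\<in>I. (g b (e i) / g (e i) (e i)) *\<^sub>R e i)) b"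
      by (simp add: expansion)
    then show ?thesis by (simp add: f.sum f.scale r.sum r.scale)
  qed
  then have "endo_trace f
      = (\<Sum>b\<in>B. \<Sum>i\<in>I. (g b (e i) / g (e i) (e i)) * representation B (f (e i)) b)"
    by (simp add: endo_trace_def Let_def B_def)
  also have "\<dots> = (\<Sum>i\<in>I. (\<Sum>b\<in>B. representation B (f (e i)) b * g b (e i)) / g (e i) (e i))"
    by (subst sum.swap) (simp add: sum_divide_distrib mult.commute)
  also have "\<dots> = (\<Sum>i\<in>I. g (f (e i)) (e i) / g (e i) (e i))"
  proof (rule sum.cong[OF refl])
    fix i
    have "(\<Sum>b\<in>B. representation B (f (e i)) b * g b (e i))
        = g (\<Sum>b\<in>B. representation B (f (e i)) b *\<^sub>R b) (e i)"
      using bilinear_lincomb_left[OF bil, of "\<lambda>b. representation B (f (e i)) b" "\<lambda>b. b" B "e i"] by simp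
    also have "(\<Sum>b\<in>B. representation B (f (e i)) b *\<^sub>R b) = f (e i)"
      using real_vector.sum_representation_eq[OF B(1), of "f (e i)" B] B(2) \<open>finite B\<close> by simp
    finally show "(\<Sum>b\<in>B. representation B (f (e i)) b * g b (e i)) / g (e i) (e i)
        = g (f (e i)) (e i) / g (e i) (e i)" by simp
  qed
  finally show ?thesis .
qed

end

section \<open>The Levi-Civita connection of a left-invariant metric\<close>

definition koszul :: "('g::real_vector \<Rightarrow> 'g \<Rightarrow> 'g) \<Rightarrow> ('g \<Rightarrow> 'g \<Rightarrow> real) \<Rightarrow> 'g \<Rightarrow> 'g \<Rightarrow> 'g \<Rightarrow> real" where
  "koszul br g u v w = (g (br u v) w - g (br v w) u + g (br w u) v) / 2"

locale metric_lie_algebra = orthogonal_frame g I e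
  for br :: "'g::real_vector \<Rightarrow> 'g \<Rightarrow> 'g" and g :: "'g \<Rightarrow> 'g \<Rightarrow> real" and I :: "'i set" and e +
  assumes lie: "lie_algebra br"
begin

lemma bil_br: "bilinear br" using lie by (simp add: lie_algebra_def)

lemmas br_simps = bilinear_ladd[OF bil_br] bilinear_radd[OF bil_br] bilinear_lsub[OF bil_br]
  bilinear_rsub[OF bil_br] bilinear_lmul[OF bil_br] bilinear_rmul[OF bil_br]
  bilinear_lneg[OF bil_br] bilinear_rneg[OF bil_br] bilinear_lzero[OF bil_br] bilinear_rzero[OF bil_br]

lemma br_self: "br x x = 0" using lie by (simp add: lie_algebra_def)

lemma br_antisym: "br x y = - br y x"
proof -
  have "br (x + y) (x + y) = br x x + br x y + (br y x + br y y)"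
    by (simp add: bilinear_ladd[OF bil_br] bilinear_radd[OF bil_br])
  then show ?thesis by (simp add: br_self eq_neg_iff_add_eq_0)
qed

text \<open>Metricity makes \<open>g (D x y) z\<close> antisymmetric in \<open>y\<close> and
  \<open>z\<close>. Writing the three brackets as differences of covariant derivatives, everything
  cancels except twice \<open>g (D u v) w\<close>. The lemma is stated for any such
  \<open>D\<close>, so it yields uniqueness as well as the formula for
  \<open>levi_civita\<close>.\<close>

lemma koszul_formula:
  assumes "\<And>u v. D u v - D v u = br u v" and "\<And>u v w. g (D u v) w + g v (D u w) = 0"
  shows "g (D u v) w = koszul br g u v w"
proof -
  have t: "g (br x y) z = g (D x y) z - g (D y x) z" for x y z
    by (simp add: assms(1)[symmetric] bil_simps)
  have m: "g (D x y) z = - g (D x z) y" for x y z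
    using assms(2)[of x y z] sym[of y "D x z"] by linarith
  show ?thesis unfolding koszul_def
    using m[of u v w] m[of v w u] m[of w u v] t[of u v w] t[of v w u] t[of w u v] by simp
qed

text \<open>This makes the definite description in \<open>levi_civita\<close> meaningful. The Koszul
  expression is linear in its last argument, hence is represented by a vector \<open>D u v\<close>,
  written down in the frame; the required properties then become identities between Koszul
  expressions.\<close>

lemma levi_civita_exists_unique:
  "\<exists>!D. bilinear D \<and> (\<forall>u v. D u v - D v u = br u v) \<and> (\<forall>u v w. g (D u v) w + g v (D u w) = 0)"
    (is "\<exists>!D. ?P D")
proof -
  define D where "D u v = (\<Sum>i\<in>I. (koszul br g u v (e i) / g (e i) (e i)) *\<^sub>R e i)" for u v
  have K: "koszul br g u v w = g (D u v) w" for u v w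
  proof -
    have lin: "linear (koszul br g u v)"
      by (rule linearI)
       (simp_all add: koszul_def br_simps bil_simps algebra_simps add_divide_distrib diff_divide_distrib)
    interpret linear "koszul br g u v" by (rule lin)
    have "koszul br g u v w = koszul br g u v (\<Sum>i\<in>I. (g w (e i) / g (e i) (e i)) *\<^sub>R e i)"
      by (simp add: expansion)
    then show ?thesis
      by (simp add: D_def sum scale bilinear_lincomb_left[OF bil] mult.commute sym[of w])
  qed
  have "?P D"
  proof (intro conjI allI)
    have 1: "D (x + y) z = D x z + D y z" "D z (x + y) = D z x + D z y"
      "D (c *\<^sub>R x) z = c *\<^sub>R D x z" "D z (c *\<^sub>R x) = c *\<^sub>R D z x" for x y z c
      by (rule inner_product_eqI[OF inner];
        simp add: bil_simps K[symmetric];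
        simp add: koszul_def br_simps bil_simps algebra_simps add_divide_distrib diff_divide_distrib)+
    show "bilinear D"
      unfolding bilinear_def by (auto intro!: linearI simp: 1)
    show "D u v - D v u = br u v" for u v
    proof (rule inner_product_eqI[OF inner])
      fix w
      have "koszul br g u v w - koszul br g v u w = g (br u v) w"
        unfolding koszul_def
        using br_antisym[of v u] br_antisym[of w u] br_antisym[of w v]
        by (simp add: bil_simps field_simps)
      then show "g (D u v - D v u) w = g (br u v) w"
        by (simp add: bil_simps K)
    qed
    show "g (D u v) w + g v (D u w) = 0" for u v w
    proof -
      have "koszul br g u v w + koszul br g u w v = 0"
        unfolding koszul_def
        using br_antisym[of w u] br_antisym[of w v] br_antisym[of v u]
        by (simp add: bil_simps field_simps)
      then show ?thesis by (simp add: K sym[of v "D u w"])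
    qed
  qed
  moreover have "D' = D" if "?P D'" for D'
    using koszul_formula[of D'] that by (intro ext inner_product_eqI[OF inner]) (simp add: K)
  ultimately show ?thesis by (rule ex1I)
qed

abbreviation D :: "'g \<Rightarrow> 'g \<Rightarrow> 'g" where "D \<equiv> levi_civita br g"

lemma
  shows bil_D: "bilinear D"
    and D_torsion_free: "D u v - D v u = br u v"
    and D_metric: "g (D u v) w + g v (D u w) = 0"
  using theI'[OF levi_civita_exists_unique] unfolding levi_civita_def by blast+

lemmas D_koszul = koszul_formula[OF D_torsion_free D_metric]

lemmas D_simps = bilinear_ladd[OF bil_D] bilinear_radd[OF bil_D] bilinear_lsub[OF bil_D]
  bilinear_rsub[OF bil_D] bilinear_lmul[OF bil_D] bilinear_rmul[OF bil_D]
  bilinear_lneg[OF bil_D] bilinear_rneg[OF bil_D] bilinear_lzero[OF bil_D] bilinear_rzero[OF bil_D]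

lemma ricci_frame:
  "ricci br g v w = (\<Sum>i\<in>I. g (riemann br g (e i) v w) (e i) / g (e i) (e i))"
  unfolding ricci_def
  by (rule endo_trace_frame, rule linearI)
    (simp_all add: riemann_def Let_def D_simps br_simps scaleR_diff_right)

text \<open>Allows Ricci components to be carried from a frame in which the metric is diagonal to
  the fixed frame in which the flow is observed.\<close>

lemma bilinear_ricci: "bilinear (ricci br g)"
  unfolding bilinear_def ricci_frame
  by (intro allI conjI linearI)
    (simp_all add: riemann_def Let_def D_simps br_simps bil_simps sum.distrib[symmetric] sum_distrib_left
      add_divide_distrib diff_divide_distrib algebra_simps)

end

section \<open>Ricci curvature for an abelian ideal extended by one direction acting without
  trace\<close>

locale semidirect = metric_lie_algebra br g "insert n J" e
  for br :: "'g::real_vector \<Rightarrow> 'g \<Rightarrow> 'g" and g :: "'g \<Rightarrow> 'g \<Rightarrow> real" and J :: "'i set" and n :: 'i and e +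
  fixes m :: "'i \<Rightarrow> 'i \<Rightarrow> real"
  assumes n_notin: "n \<notin> J"
    and abelian: "\<And>i j. \<lbrakk>i \<in> J; j \<in> J\<rbrakk> \<Longrightarrow> br (e i) (e j) = 0"
    and action: "\<And>j. j \<in> J \<Longrightarrow> br (e j) (e n) = (\<Sum>i\<in>J. m i j *\<^sub>R e i)"
    and unimodular: "(\<Sum>i\<in>J. m i i) = 0"
begin

abbreviation q :: "'i \<Rightarrow> real" where "q i \<equiv> g (e i) (e i)"

text \<open>The symmetric part of the form \<open>g (br (e j) (e n)) (e i)\<close> on the ideal. Up
  to sign it is the second fundamental form of the ideal, paired with \<open>e n\<close>.\<close>

abbreviation s :: "'i \<Rightarrow> 'i \<Rightarrow> real" where "s i j \<equiv> (m i j * q i + m j i * q j) / 2"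

lemma finite_J: "finite J" using finite_index by simp

lemma g_comb:
  assumes "j \<in> J"
  shows "g (\<Sum>i\<in>J. c i *\<^sub>R e i) (e j) = c j * q j"
proof -
  have "(\<Sum>i\<in>J. c i * g (e i) (e j)) = (\<Sum>i\<in>J. if i = j then c j * q j else 0)"
    using orthogonal assms by (intro sum.cong) auto
  then show ?thesis
    using assms finite_J by (simp add: bilinear_lincomb_left[OF bil])
qed

lemma g_comb_n: "g (\<Sum>i\<in>J. c i *\<^sub>R e i) (e n) = 0"
proof -
  have "g (e i) (e n) = 0" if "i \<in> J" for i
    using orthogonal n_notin that by blast
  then show ?thesis by (simp add: bilinear_lincomb_left[OF bil])
qed

lemma g_J_n: "j \<in> J \<Longrightarrow> g (e j) (e n) = 0" "j \<in> J \<Longrightarrow> g (e n) (e j) = 0"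
  using orthogonal n_notin by auto

lemma action': "j \<in> J \<Longrightarrow> br (e n) (e j) = - (\<Sum>i\<in>J. m i j *\<^sub>R e i)"
  using br_antisym[of "e n"] action by simp

lemmas g_frame = g_comb g_comb_n g_J_n action action' abelian bil_simps

text \<open>This and the next three lemmas evaluate the Koszul formula on the frame. Derivatives
  along the ideal see only the symmetric part \<open>s\<close> of the action; in \<open>D_nJ\<close>
  the coefficient is its antisymmetric part, since subtracting \<open>m j a\<close> flips one sign
  in \<open>s a j / q j\<close>.\<close>

lemma D_JJ: "\<lbrakk>a \<in> J; b \<in> J\<rbrakk> \<Longrightarrow> D (e a) (e b) = (- s a b / q n) *\<^sub>R e n"
  using norm_pos[of n]
  by (intro frame_eqI) (auto simp: D_koszul koszul_def g_frame)

lemma D_Jn: "a \<in> J \<Longrightarrow> D (e a) (e n) = (\<Sum>j\<in>J. (s a j / q j) *\<^sub>R e j)"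
  using norm_pos
  by (intro frame_eqI) (auto simp: D_koszul koszul_def g_frame br_self less_imp_neq[symmetric])

lemma D_nJ: "a \<in> J \<Longrightarrow> D (e n) (e a) = (\<Sum>j\<in>J. (s a j / q j - m j a) *\<^sub>R e j)"
  using norm_pos
  by (intro frame_eqI) (auto simp: D_koszul koszul_def g_frame br_self less_imp_neq[symmetric] field_simps)

lemma D_nn: "D (e n) (e n) = 0"
  by (intro frame_eqI) (auto simp: D_koszul koszul_def g_frame br_self)

lemma D_sum:
  "D (\<Sum>j\<in>A. c j *\<^sub>R e j) v = (\<Sum>j\<in>A. c j *\<^sub>R D (e j) v)"
  "D v (\<Sum>j\<in>A. c j *\<^sub>R e j) = (\<Sum>j\<in>A. c j *\<^sub>R D v (e j))"
proof -
  interpret l: linear "\<lambda>x. D x v" using bil_D by (simp add: bilinear_def)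
  interpret r: linear "D v" using bil_D by (simp add: bilinear_def)
  show "D (\<Sum>j\<in>A. c j *\<^sub>R e j) v = (\<Sum>j\<in>A. c j *\<^sub>R D (e j) v)"
    by (simp add: l.sum l.scale)
  show "D v (\<Sum>j\<in>A. c j *\<^sub>R e j) = (\<Sum>j\<in>A. c j *\<^sub>R D v (e j))"
    by (simp add: r.sum r.scale)
qed

text \<open>This is the Gauss equation for the ideal, which is intrinsically flat because it is
  abelian.\<close>

lemma riemann_JJJ:
  assumes "i \<in> J" "a \<in> J" "b \<in> J"
  shows "g (riemann br g (e i) (e a) (e b)) (e i) = (s i b * s a i - s a b * s i i) / q n"
proof -
  have "riemann br g (e i) (e a) (e b)
      = (s i b / q n) *\<^sub>R (\<Sum>j\<in>J. (s a j / q j) *\<^sub>R e j)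
        - (s a b / q n) *\<^sub>R (\<Sum>j\<in>J. (s i j / q j) *\<^sub>R e j)"
    using assms by (simp add: riemann_def D_JJ D_Jn abelian D_simps)
  then show ?thesis
    using assms norm_pos[of i] by (simp add: bil_simps g_comb diff_divide_distrib)
qed

lemma riemann_nJJ:
  assumes "a \<in> J" "b \<in> J"
  shows "g (riemann br g (e n) (e a) (e b)) (e n) = (\<Sum>j\<in>J. (s b j / q j - m j b) * s a j - m j a * s j b)"
proof -
  have 1: "D (e a) (D (e n) (e b)) = (\<Sum>j\<in>J. (s b j / q j - m j b) *\<^sub>R ((- s a j / q n) *\<^sub>R e n))"
    using assms unfolding D_nJ[OF assms(2)] D_sum by (intro sum.cong refl) (simp only: D_JJ)
  have 2: "D (br (e n) (e a)) (e b) = - (\<Sum>j\<in>J. m j a *\<^sub>R ((- s j b / q n) *\<^sub>R e n))"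
    using assms by (simp add: action' D_simps D_sum D_JJ)
  have 3: "D (e n) (D (e a) (e b)) = 0"
    using assms by (simp add: D_JJ D_simps D_nn)
  have "riemann br g (e n) (e a) (e b)
      = (\<Sum>j\<in>J. ((s b j / q j - m j b) * s a j - m j a * s j b) / q n) *\<^sub>R e n"
    unfolding riemann_def Let_def 1 2 3
    by (simp add: scaleR_sum_left sum_subtractf[symmetric] sum_negf[symmetric] diff_divide_distrib scaleR_diff_left)
  then show ?thesis
    using norm_pos[of n] by (simp add: bil_simps sum_divide_distrib[symmetric])
qed

lemma ricci_JJ:
  assumes "a \<in> J" "b \<in> J"
  shows "ricci br g (e a) (e b)
    = (\<Sum>j\<in>J. m a j * m b j * q a * q b / q j - m j a * m j b * q j) / (2 * q n)"
proof -
  have nz: "q j \<noteq> 0" if "j \<in> J" for j using norm_pos[of j] that by simp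
  have nn: "q n \<noteq> 0" using norm_pos[of n] by simp
  \<comment> \<open>Since \<open>s i i / q i = m i i\<close>, the terms containing
    \<open>s a b\<close> add up to a multiple of the trace of \<open>m\<close> and drop out.\<close>
  have "(\<Sum>i\<in>J. g (riemann br g (e i) (e a) (e b)) (e i) / q i)
      = (\<Sum>i\<in>J. (s i b * s a i / q i - s a b * m i i) / q n)"
    using assms nz nn by (intro sum.cong) (simp_all add: riemann_JJJ field_simps)
  also have "\<dots> = (\<Sum>i\<in>J. s i b * s a i / q i) / q n"
    using unimodular by (simp add: sum_divide_distrib[symmetric] sum_subtractf sum_distrib_left[symmetric])
  finally have "ricci br g (e a) (e b)
      = (\<Sum>j\<in>J. s j b * s a j / q j + ((s b j / q j - m j b) * s a j - m j a * s j b)) / q n"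
    using assms n_notin finite_J
    by (simp add: ricci_frame riemann_nJJ sum.distrib add_divide_distrib)
  \<comment> \<open>The identity holds summand by summand: after expanding \<open>s\<close>, the
    products that mix \<open>m a j\<close> with \<open>m j b\<close>, or \<open>m j a\<close> with
    \<open>m b j\<close>, cancel.\<close>
  also have "\<dots> = (\<Sum>j\<in>J. (m a j * m b j * q a * q b / q j - m j a * m j b * q j) / 2) / q n"
    using nz by (intro arg_cong[where f = "\<lambda>x. x / q n"] sum.cong refl) (simp add: field_simps)
  finally show ?thesis by (simp add: sum_divide_distrib[symmetric])
qed

text \<open>Each curvature vector in the trace is orthogonal to the frame vector it is paired with:
  for \<open>i\<close> in \<open>J\<close> it is a multiple of \<open>e n\<close>, and for
  \<open>n\<close> it lies in the ideal.\<close>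

lemma ricci_Jn:
  assumes "a \<in> J"
  shows "ricci br g (e a) (e n) = 0"
proof -
  have 1: "g (riemann br g (e i) (e a) (e n)) (e i) = 0" if "i \<in> J" for i
  proof -
    have "riemann br g (e i) (e a) (e n)
      = (\<Sum>j\<in>J. (s a j / q j) *\<^sub>R ((- s i j / q n) *\<^sub>R e n)) - (\<Sum>j\<in>J. (s i j / q j) *\<^sub>R ((- s a j / q n) *\<^sub>R e n))"
      unfolding riemann_def Let_def D_Jn[OF assms] D_Jn[OF that] D_sum abelian[OF that assms] bilinear_lzero[OF bil_D] diff_zero
      using assms that by (intro arg_cong2[where f = minus] sum.cong refl) (simp_all only: D_JJ)
    then have "riemann br g (e i) (e a) (e n)
      = (\<Sum>j\<in>J. (s a j / q j) * (- s i j / q n)) *\<^sub>R e n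
        - (\<Sum>j\<in>J. (s i j / q j) * (- s a j / q n)) *\<^sub>R e n"
      unfolding scaleR_sum_left scaleR_scaleR .
    then show ?thesis using that by (simp add: bil_simps g_J_n)
  qed
  have 2: "g (riemann br g (e n) (e a) (e n)) (e n) = 0"
  proof -
    have "D (e n) (\<Sum>j\<in>J. c j *\<^sub>R e j) = (\<Sum>j\<in>J. c j *\<^sub>R (\<Sum>i\<in>J. (s j i / q i - m i j) *\<^sub>R e i))" for c
      unfolding D_sum by (intro sum.cong refl) (simp only: D_nJ)
    moreover have "D (\<Sum>j\<in>J. c j *\<^sub>R e j) (e n) = (\<Sum>j\<in>J. c j *\<^sub>R (\<Sum>i\<in>J. (s j i / q i) *\<^sub>R e i))" for c
      unfolding D_sum by (intro sum.cong refl) (simp only: D_Jn)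
    moreover have "g (\<Sum>j\<in>J. c j *\<^sub>R (\<Sum>i\<in>J. d j i *\<^sub>R e i)) (e n) = 0" for c d
      using bilinear_lincomb_left[OF bil, of c "\<lambda>j. \<Sum>i\<in>J. d j i *\<^sub>R e i" J "e n"]
      unfolding g_comb_n by simp
    ultimately show ?thesis
      using assms by (simp add: riemann_def D_nn D_Jn action' D_simps bil_simps)
  qed
  show ?thesis
    using 1 2 n_notin finite_J by (simp add: ricci_frame)
qed

end

section \<open>The given Lie algebra and its diagonal metrics\<close>

declare One_nat_def [simp del]

locale solvable_lie_algebra =
  fixes br :: "'g::real_vector \<Rightarrow> 'g \<Rightarrow> 'g" and X :: "nat \<Rightarrow> 'g" and k :: real
  assumes lie: "lie_algebra br"
    and inj: "inj_on X {1..4}" and basis: "is_basis (X ` {1..4})"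
    and br_23: "br (X 2) (X 3) = 0" and br_31: "br (X 3) (X 1) = 0" and br_12: "br (X 1) (X 2) = 0"
    and br_14: "br (X 1) (X 4) = k *\<^sub>R X 1 + X 2"
    and br_24: "br (X 2) (X 4) = - X 1 + k *\<^sub>R X 2"
    and br_34: "br (X 3) (X 4) = (- 2 * k) *\<^sub>R X 3"
begin

lemma index_set: "{1..4::nat} = {1, 2, 3, 4}"
  by auto

text \<open>Each vector has coordinate 1 along one of the basis vectors.\<close>

lemma frame_nonzero:
  fixes a1 a2 a3 c1 c2 c3 :: real
  shows "X 1 + a2 *\<^sub>R X 2 + a3 *\<^sub>R X 3 \<noteq> 0" "X 2 + a1 *\<^sub>R X 3 \<noteq> 0" "X 3 \<noteq> 0"
    "X 4 + c1 *\<^sub>R X 1 + c2 *\<^sub>R X 2 + c3 *\<^sub>R X 3 \<noteq> 0"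
proof -
  have B: "independent (X ` {1..4})" "span (X ` {1..4}) = UNIV"
    using basis by (auto simp: is_basis_def)
  define f where "f i v = representation (X ` {1..4}) v (X i)" for i v
  have lin: "linear (f i)" for i
    unfolding f_def
    by (rule linearI) (simp_all add: B real_vector.representation_add real_vector.representation_scale)
  have dual: "f i (X j) = (if j = i then 1 else 0)" if "i \<in> {1..4}" "j \<in> {1..4}" for i j
    unfolding f_def using real_vector.representation_basis[OF B(1), of "X j"] that inj
    by (auto simp: inj_on_eq_iff)
  note f = linear_add[OF lin] linear_scale[OF lin] dual
  have nonzero: "v \<noteq> 0" if "f i v = 1" for i v
    using that linear_0[OF lin] by fastforce
  show "X 1 + a2 *\<^sub>R X 2 + a3 *\<^sub>R X 3 \<noteq> 0" by (rule nonzero[of 1]) (simp add: f)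
  show "X 2 + a1 *\<^sub>R X 3 \<noteq> 0" by (rule nonzero[of 2]) (simp add: f)
  show "X 3 \<noteq> 0" by (rule nonzero[of 3]) (simp add: f)
  show "X 4 + c1 *\<^sub>R X 1 + c2 *\<^sub>R X 2 + c3 *\<^sub>R X 3 \<noteq> 0" by (rule nonzero[of 4]) (simp add: f)
qed

end

text \<open>Frame and metric are parameters, because the locale is used both for \<open>Y\<close>
  with the initial metric and for the Gram-Schmidt frame of the metric at every later time.\<close>

locale diagonal_metric = solvable_lie_algebra br X k
  for br :: "'g::real_vector \<Rightarrow> 'g \<Rightarrow> 'g" and X :: "nat \<Rightarrow> 'g" and k :: real +
  fixes a1 a2 a3 c1 c2 c3 :: real and W :: "nat \<Rightarrow> 'g" and g :: "'g \<Rightarrow> 'g \<Rightarrow> real"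
  assumes inner: "inner_product g"
    and W: "W 1 = X 1 + a2 *\<^sub>R X 2 + a3 *\<^sub>R X 3" "W 2 = X 2 + a1 *\<^sub>R X 3" "W 3 = X 3"
      "W 4 = X 4 + c1 *\<^sub>R X 1 + c2 *\<^sub>R X 2 + c3 *\<^sub>R X 3"
    and orth: "\<And>i j. \<lbrakk>i \<in> {1..4}; j \<in> {1..4}; i < j\<rbrakk> \<Longrightarrow> g (W i) (W j) = 0"
begin

text \<open>\<rho> and \<omega> are the \<open>W 3\<close> components of
  \<open>br (W 1) (W 4)\<close> and \<open>br (W 2) (W 4)\<close>. They measure how far the plane of
  \<open>W 1\<close> and \<open>W 2\<close> is from being invariant under the action.\<close>

definition \<rho> :: real where "\<rho> = (a2 - 3 * k) * a3 - (1 + a2\<^sup>2) * a1"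
definition \<omega> :: real where "\<omega> = a3 - (a2 + 3 * k) * a1"

text \<open>Columns are the images of \<open>W 1\<close>, \<open>W 2\<close>, \<open>W 3\<close>
  under the bracket with \<open>W 4\<close>. The parameters \<open>c1\<close>, \<open>c2\<close>,
  \<open>c3\<close> do not occur, since they change \<open>W 4\<close> only within the abelian
  ideal. List positions start at 0, hence the shifts by 1.\<close>

definition action_matrix :: "nat \<Rightarrow> nat \<Rightarrow> real" where
  "action_matrix i j =
    [[k - a2, - 1, 0], [1 + a2\<^sup>2, k + a2, 0], [\<rho>, \<omega>, - 2 * k]] ! (i - 1) ! (j - 1)"

lemma frame_spans: "span (W ` {1..4}) = UNIV"
proof -
  have W_in: "W i \<in> span (W ` {1..4})" if "i \<in> {1..4}" for i
    using that by (intro span_base) auto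
  have X3: "X 3 \<in> span (W ` {1..4})" using W_in[of 3] W by simp
  have X2: "X 2 \<in> span (W ` {1..4})"
    using span_diff[OF W_in[of 2] span_scale[OF X3, of a1]] W by simp
  have X1_eq: "X 1 = W 1 - (a2 *\<^sub>R X 2 + a3 *\<^sub>R X 3)" using W by simp
  have X1: "X 1 \<in> span (W ` {1..4})"
    unfolding X1_eq by (intro span_diff span_add span_scale W_in X2 X3) simp
  have X4_eq: "X 4 = W 4 - (c1 *\<^sub>R X 1 + c2 *\<^sub>R X 2 + c3 *\<^sub>R X 3)" using W by simp
  have X4: "X 4 \<in> span (W ` {1..4})"
    unfolding X4_eq by (intro span_diff span_add span_scale W_in X1 X2 X3) simp
  have "X ` {1..4} \<subseteq> span (W ` {1..4})"
    unfolding index_set using X1 X2 X3 X4 unfolding index_set by auto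
  then have "span (X ` {1..4}) \<subseteq> span (W ` {1..4})"
    by (rule span_minimal) (rule subspace_span)
  then show ?thesis using basis by (auto simp: is_basis_def)
qed

sublocale orthogonal_frame g "insert 4 {1, 2, 3}" W
proof
  show "inner_product g" by (rule inner)
  show "span (W ` insert 4 {1, 2, 3}) = UNIV"
    using frame_spans unfolding index_set by (simp add: insert_commute)
  show "W i \<noteq> 0" if "i \<in> insert 4 {1, 2, 3}" for i
    using that frame_nonzero W by auto
  show "g (W i) (W j) = 0" if "i \<in> insert 4 {1, 2, 3}" "j \<in> insert 4 {1, 2, 3}" "i \<noteq> j" for i j
  proof (cases "i < j")
    case True
    then show ?thesis using orth[of i j] that by auto
  next
    case False
    then have "g (W j) (W i) = 0" using orth[of j i] that by auto
    then show ?thesis using inner_productD(2)[OF inner] by metis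
  qed
qed auto

sublocale metric_lie_algebra br g "insert 4 {1, 2, 3}" W
  by unfold_locales (rule lie)

sublocale semidirect br g "{1, 2, 3}" 4 W action_matrix
proof
  have br_21: "br (X 2) (X 1) = 0" "br (X 3) (X 2) = 0" "br (X 1) (X 3) = 0"
    using br_12 br_23 br_31 br_antisym by (metis neg_equal_zero neg_0_equal_iff_equal)+
  note brX = br_12 br_23 br_31 br_14 br_24 br_34 br_21 br_self
  show "br (W i) (W j) = 0" if "i \<in> {1, 2, 3}" "j \<in> {1, 2, 3}" for i j
    using that by (auto simp: W br_simps brX)
  show "br (W j) (W 4) = (\<Sum>i\<in>{1, 2, 3}. action_matrix i j *\<^sub>R W i)" if j: "j \<in> {1, 2, 3}" for j
  proof -
    consider "j = 1" | "j = 2" | "j = 3" using j by auto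
    then show ?thesis
      by (cases, simp_all add: action_matrix_def W br_simps brX \<rho>_def \<omega>_def
         scaleR_add_left scaleR_add_right scaleR_diff_left scaleR_diff_right algebra_simps power2_eq_square, simp_all flip: scaleR_add_left)
  qed
qed (simp_all add: action_matrix_def)

lemma ricci_off_diagonal:
  shows "ricci br g (W 1) (W 2) = (- 2 * a2 * ((1 + a2\<^sup>2) * q 2 + q 1) - \<rho> * \<omega> * q 3) / (2 * q 4)"
    and "ricci br g (W 1) (W 3) = ((3 * k - a2) * \<rho> * q 3 - \<omega> * q 3 * q 1 / q 2) / (2 * q 4)"
    and "ricci br g (W 2) (W 3) = ((1 + a2\<^sup>2) * \<rho> * q 3 * q 2 / q 1 + (3 * k + a2) * \<omega> * q 3) / (2 * q 4)"
  using norm_pos[of 1] norm_pos[of 2] norm_pos[of 3] norm_pos[of 4]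
  by (simp_all add: ricci_JJ action_matrix_def field_simps)

lemma ricci_sym:
  assumes "i \<in> {1, 2, 3}" "j \<in> {1, 2, 3}"
  shows "ricci br g (W i) (W j) = ricci br g (W j) (W i)"
  unfolding ricci_JJ[OF assms] ricci_JJ[OF assms(2,1)] by (simp add: mult_ac)

lemma ricci_diagonal:
  shows "ricci br g (W 1) (W 1) = ((q 1)\<^sup>2 / q 2 - (1 + a2\<^sup>2)\<^sup>2 * q 2 - \<rho>\<^sup>2 * q 3) / (2 * q 4)"
    and "ricci br g (W 2) (W 2) = ((1 + a2\<^sup>2)\<^sup>2 * (q 2)\<^sup>2 / q 1 - q 1 - \<omega>\<^sup>2 * q 3) / (2 * q 4)"
    and "ricci br g (W 3) (W 3) = (\<rho>\<^sup>2 * (q 3)\<^sup>2 / q 1 + \<omega>\<^sup>2 * (q 3)\<^sup>2 / q 2) / (2 * q 4)"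
  using norm_pos[of 1] norm_pos[of 2] norm_pos[of 3] norm_pos[of 4]
  by (simp_all add: ricci_JJ action_matrix_def field_simps power2_eq_square)

text \<open>The components (1,3) and (2,3) force \<rho> and \<omega> to vanish. The component (1,2)
  is then \<open>a2\<close> times a negative factor, so \<open>a2 = 0\<close>, and the equations for
  \<rho> and \<omega> become a linear system in \<open>a1\<close> and \<open>a3\<close>, again
  nondegenerate because \<open>1 + 9 * k^2\<close> is positive.\<close>

lemma ricci_diagonal_imp:
  assumes "ricci br g (W 1) (W 2) = 0" "ricci br g (W 1) (W 3) = 0" "ricci br g (W 2) (W 3) = 0"
  shows "a1 = 0 \<and> a2 = 0 \<and> a3 = 0"
proof -
  have p: "q 1 > 0" "q 2 > 0" "q 3 > 0" "q 4 > 0" using norm_pos by auto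
  have 1: "(3 * k - a2) * \<rho> * q 2 = \<omega> * q 1"
  proof -
    have "q 3 * ((3 * k - a2) * \<rho> * q 2 - \<omega> * q 1) = 0"
      using assms(2) p unfolding ricci_off_diagonal by (simp add: field_simps)
    then show ?thesis using p by simp
  qed
  have 2: "(1 + a2\<^sup>2) * \<rho> * q 2 + (3 * k + a2) * \<omega> * q 1 = 0"
  proof -
    have "q 3 * ((1 + a2\<^sup>2) * \<rho> * q 2 + (3 * k + a2) * \<omega> * q 1) = 0"
      using assms(3) p unfolding ricci_off_diagonal by (simp add: field_simps)
    then show ?thesis using p by simp
  qed
  \<comment> \<open>A homogeneous linear system for \<open>(\<rho> * q 2, \<omega> * q 1)\<close> with determinant \<open>1 + 9 * k\<^sup>2\<close>.\<close>
  have "\<rho> * q 2 * ((1 + a2\<^sup>2) + (3 * k + a2) * (3 * k - a2)) = 0"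
    using 1 2 by algebra
  then have "\<rho> * q 2 * (1 + 9 * k\<^sup>2) = 0"
    by (simp add: algebra_simps power2_eq_square)
  moreover have "1 + 9 * k\<^sup>2 > 0" using zero_le_power2[of k] by linarith
  ultimately have \<rho>: "\<rho> = 0" using p by auto
  then have \<omega>: "\<omega> = 0" using 1 p by simp
  have "(1 + a2\<^sup>2) * q 2 + q 1 > 0" using p by (simp add: add_nonneg_pos pos_add_strict)
  then have a2: "a2 = 0"
    using assms(1) p \<rho> unfolding ricci_off_diagonal by auto
  have "a1 * (1 + 9 * k\<^sup>2) = 0"
    using \<rho> \<omega> a2 unfolding \<rho>_def \<omega>_def by algebra
  then have "a1 = 0" using \<open>1 + 9 * k\<^sup>2 > 0\<close> by auto
  then show ?thesis using \<omega> a2 unfolding \<omega>_def by simp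
qed

end

section \<open>Uniform bounds on compact intervals and Gronwall's inequality\<close>

lemma bigo_mult_continuous:
  fixes f c S :: "real \<Rightarrow> real"
  assumes "f \<in> O[principal {a..b}](S)" "continuous_on {a..b} c"
  shows "(\<lambda>x. f x * c x) \<in> O[principal {a..b}](S)"
proof -
  \<comment> \<open>Over the filter \<open>principal {a..b}\<close> the O-notation means a bound
    with a single constant at every point of the interval. A continuous factor is bounded there and
    is absorbed into that constant.\<close>
  have "bounded (c ` {a..b})"
    by (intro compact_imp_bounded compact_continuous_image assms) simp
  then obtain B where "\<forall>x\<in>{a..b}. norm (c x) \<le> B" by (auto simp: bounded_iff)
  then have "c \<in> O[principal {a..b}](\<lambda>_. 1)"
    by (intro bigoI[of _ B]) (simp add: eventually_principal)
  then show ?thesis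
    using landau_o.big.mult[OF assms(1), of c "\<lambda>_. 1"] by simp
qed

lemma bigo_divide_continuous:
  fixes f c S :: "real \<Rightarrow> real"
  assumes "f \<in> O[principal {a..b}](S)" "continuous_on {a..b} c" "\<And>x. x \<in> {a..b} \<Longrightarrow> c x \<noteq> 0"
  shows "(\<lambda>x. f x / c x) \<in> O[principal {a..b}](S)"
  using bigo_mult_continuous[OF assms(1), of "\<lambda>x. inverse (c x)"] assms(2,3)
  by (simp add: divide_inverse continuous_on_inverse)

text \<open>Gronwall's argument for the sum of squares \<open>E\<close>: the bound gives
  \<open>E' t \<le> K * E t\<close>, so \<open>exp (- K * t) * E t\<close> is nonincreasing. It
  starts at 0 and is nonnegative.\<close>

lemma linear_system_unique_zero:
  fixes x x' :: "'i \<Rightarrow> real \<Rightarrow> real"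
  assumes A: "finite A"
    and deriv: "\<And>i t. \<lbrakk>i \<in> A; t \<in> {0..b}\<rbrakk> \<Longrightarrow> (x i has_real_derivative x' i t) (at t within {0..b})"
    and init: "\<And>i. i \<in> A \<Longrightarrow> x i 0 = 0"
    and bound: "\<And>i. i \<in> A \<Longrightarrow> x' i \<in> O[principal {0..b}](\<lambda>t. \<Sum>j\<in>A. \<bar>x j t\<bar>)"
    and i: "i \<in> A" and t: "t \<in> {0..b}"
  shows "x i t = 0"
proof -
  have "\<forall>i\<in>A. \<exists>c. \<forall>t\<in>{0..b}. \<bar>x' i t\<bar> \<le> c * (\<Sum>j\<in>A. \<bar>x j t\<bar>)"
    using bound by (force elim!: landau_o.bigE simp: eventually_principal)
  then obtain c where c: "\<And>i t. \<lbrakk>i \<in> A; t \<in> {0..b}\<rbrakk> \<Longrightarrow> \<bar>x' i t\<bar> \<le> c i * (\<Sum>j\<in>A. \<bar>x j t\<bar>)"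
    by metis
  define C where "C = (\<Sum>i\<in>A. \<bar>c i\<bar>)"
  have C: "\<bar>x' i t\<bar> \<le> C * (\<Sum>j\<in>A. \<bar>x j t\<bar>)" if "i \<in> A" "t \<in> {0..b}" for i t
  proof -
    have "c i \<le> C" unfolding C_def
      using member_le_sum[of i A "\<lambda>i. \<bar>c i\<bar>"] that A by force
    then show ?thesis
      using c[OF that] by (meson mult_right_mono order_trans abs_ge_zero sum_nonneg)
  qed
  have "C \<ge> 0" unfolding C_def by (simp add: sum_nonneg)
  define E where "E t = (\<Sum>i\<in>A. (x i t)\<^sup>2)" for t
  define E' where "E' t = (\<Sum>i\<in>A. 2 * x i t * x' i t)" for t
  \<comment> \<open>The factor \<open>2 * card A\<close> arises from bounding
    \<open>2 * \<bar>x i t\<bar> * \<bar>x j t\<bar>\<close> by the sum of the two squares and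
    summing over all \<open>i\<close> and \<open>j\<close>.\<close>
  define K where "K = 2 * C * card A"
  have E_deriv: "(E has_real_derivative E' t) (at t within {0..b})" if "t \<in> {0..b}" for t
    unfolding E_def E'_def
    by (rule DERIV_sum, rule DERIV_cong[OF DERIV_power[OF deriv[OF _ that]]]) (auto simp: mult_ac)
  have E'_le: "E' t \<le> K * E t" if t: "t \<in> {0..b}" for t
  proof -
    have "E' t \<le> (\<Sum>i\<in>A. 2 * \<bar>x i t\<bar> * (C * (\<Sum>j\<in>A. \<bar>x j t\<bar>)))"
      unfolding E'_def
    proof (rule sum_mono)
      fix i assume i: "i \<in> A"
      have "2 * x i t * x' i t \<le> 2 * \<bar>x i t\<bar> * \<bar>x' i t\<bar>"
        by (metis abs_ge_self abs_mult abs_numeral)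
      also have "\<dots> \<le> 2 * \<bar>x i t\<bar> * (C * (\<Sum>j\<in>A. \<bar>x j t\<bar>))"
        using C[OF i t] by (intro mult_left_mono) auto
      finally show "2 * x i t * x' i t \<le> 2 * \<bar>x i t\<bar> * (C * (\<Sum>j\<in>A. \<bar>x j t\<bar>))" .
    qed
    also have "\<dots> = C * (\<Sum>i\<in>A. \<Sum>j\<in>A. 2 * \<bar>x i t\<bar> * \<bar>x j t\<bar>)"
      by (simp add: sum_distrib_left mult_ac)
    also have "\<dots> \<le> C * (\<Sum>i\<in>A. \<Sum>j\<in>A. (x i t)\<^sup>2 + (x j t)\<^sup>2)"
    proof -
      have "2 * \<bar>x i t\<bar> * \<bar>x j t\<bar> \<le> (x i t)\<^sup>2 + (x j t)\<^sup>2" for i j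
        using sum_squares_bound[of "\<bar>x i t\<bar>" "\<bar>x j t\<bar>"] by simp
      then show ?thesis using \<open>C \<ge> 0\<close> by (intro mult_left_mono sum_mono)
    qed
    also have "\<dots> = K * E t"
      by (simp add: sum.distrib E_def K_def sum_distrib_left[symmetric] algebra_simps)
    finally show ?thesis .
  qed
  define f where "f t = exp (- K * t) * E t" for t
  have f_deriv: "(f has_real_derivative exp (- K * t) * (E' t - K * E t)) (at t within {0..b})"
    if "t \<in> {0..b}" for t
  proof -
    have "((\<lambda>t. exp (- K * t)) has_real_derivative exp (- K * t) * (- K)) (at t within {0..b})"
      by (auto intro!: derivative_eq_intros)
    from DERIV_cong[OF DERIV_mult[OF this E_deriv[OF that]]]
    show ?thesis unfolding f_def by (simp add: algebra_simps)
  qed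
  have "f t \<le> f 0"
  proof (rule DERIV_nonpos_imp_decreasing_open[of 0 t f])
    show "0 \<le> t" using t by simp
    show "\<exists>y. (f has_real_derivative y) (at s) \<and> y \<le> 0" if s: "0 < s" "s < t" for s
    proof -
      \<comment> \<open>At an interior point the derivative within the closed interval is the
        two-sided derivative.\<close>
      have "s \<in> {0<..<b}" using s t by auto
      then have "(f has_real_derivative exp (- K * s) * (E' s - K * E s)) (at s within {0<..<b})"
        using DERIV_subset[OF f_deriv[of s], of "{0<..<b}"] by force
      then have "(f has_real_derivative exp (- K * s) * (E' s - K * E s)) (at s)"
        using \<open>s \<in> {0<..<b}\<close> by (simp add: at_within_open[of s "{0<..<b}"])
      moreover have "exp (- K * s) * (E' s - K * E s) \<le> 0"
        using E'_le[of s] \<open>s \<in> {0<..<b}\<close> by (simp add: mult_nonneg_nonpos)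
      ultimately show ?thesis by blast
    qed
    have "continuous_on {0..b} f"
      using f_deriv by (intro DERIV_continuous_on) blast
    then show "continuous_on {0..t} f"
      using t by (elim continuous_on_subset) auto
  qed
  moreover have "f 0 = 0" using init by (simp add: f_def E_def)
  moreover have "E t \<ge> 0" by (simp add: E_def sum_nonneg)
  ultimately have "E t = 0"
    by (simp add: f_def mult_le_0_iff)
  then show ?thesis
    using A i by (simp add: E_def sum_nonneg_eq_0_iff)
qed

section \<open>Gram-Schmidt frames and preservation of diagonality\<close>

context solvable_lie_algebra
begin

text \<open>Gram-Schmidt is run in the order 3, 2, 1, 4, which produces exactly the triangular shape
  required by \<open>diagonal_metric\<close>. Coefficients and squared lengths are given as explicit
  rational expressions in the components \<open>h\<close>, since along the flow both their
  continuity and their size must be read off.\<close>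

lemma diagonal_metric_gram_schmidt:
  fixes c1 c2 c3 :: real and G :: "'g \<Rightarrow> 'g \<Rightarrow> real"
  assumes inner: "inner_product G"
    and Z_def: "Z = X(4 := X 4 + c1 *\<^sub>R X 1 + c2 *\<^sub>R X 2 + c3 *\<^sub>R X 3)"
    and h_def: "h = (\<lambda>i j. G (Z i) (Z j))"
    and a_def: "a = - h 2 3 / h 3 3"
    and l2_def: "l2 = h 2 2 + a * h 2 3"
    and b2_def: "b2 = - (h 1 2 + a * h 1 3) / l2"
    and b3_def: "b3 = - h 1 3 / h 3 3"
    and l1_def: "l1 = h 1 1 + b2 * (h 1 2 + a * h 1 3) + b3 * h 1 3"
    and d3_def: "d3 = - h 3 4 / h 3 3"
    and d2_def: "d2 = - (h 2 4 + a * h 3 4) / l2"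
    and d1_def: "d1 = - (h 1 4 + b2 * (h 2 4 + a * h 3 4) + b3 * h 3 4) / l1"
    and l4_def: "l4 = h 4 4 + d1 * (h 1 4 + b2 * (h 2 4 + a * h 3 4) + b3 * h 3 4)
    + d2 * (h 2 4 + a * h 3 4) + d3 * h 3 4"
    and W3_def: "W3 = Z 3"
    and W2_def: "W2 = Z 2 + a *\<^sub>R W3"
    and W1_def: "W1 = Z 1 + b2 *\<^sub>R W2 + b3 *\<^sub>R W3"
    and W4_def: "W4 = Z 4 + d1 *\<^sub>R W1 + d2 *\<^sub>R W2 + d3 *\<^sub>R W3"
    and W_def: "W = (\<lambda>_. 0)(1 := W1, 2 := W2, 3 := W3, 4 := W4)"
  shows "diagonal_metric br X k a b2 (b2 * a + b3) (c1 + d1) (c2 + d1 * b2 + d2)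
     (c3 + d1 * (b2 * a + b3) + d2 * a + d3) W G"
    and "G W1 W1 = l1" "G W2 W2 = l2" "G W3 W3 = h 3 3" "G W4 W4 = l4"
    and "0 < l1" "0 < l2" "0 < h 3 3" "0 < l4"
proof -
  note bil = inner_productD(1)[OF inner]
  note sym = inner_productD(2)[OF inner]
  note pos = inner_productD(3)[OF inner]
  note bil_simps = bilinear_ladd[OF bil] bilinear_radd[OF bil] bilinear_lmul[OF bil] bilinear_rmul[OF bil]
    bilinear_lsub[OF bil] bilinear_rsub[OF bil]
  have h: "G (Z i) (Z j) = h i j" "h 2 1 = h 1 2" "h 3 1 = h 1 3" "h 4 1 = h 1 4" "h 3 2 = h 2 3"
    "h 4 2 = h 2 4" "h 4 3 = h 3 4" for i j
    by (auto simp: h_def intro: sym)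
  have W_eq: "W1 = X 1 + b2 *\<^sub>R X 2 + (b2 * a + b3) *\<^sub>R X 3" "W2 = X 2 + a *\<^sub>R X 3" "W3 = X 3"
    "W4 = X 4 + (c1 + d1) *\<^sub>R X 1 + (c2 + d1 * b2 + d2) *\<^sub>R X 2
      + (c3 + d1 * (b2 * a + b3) + d2 * a + d3) *\<^sub>R X 3"
    by (simp_all add: W1_def W2_def W3_def W4_def Z_def algebra_simps)
  have nonzero: "W1 \<noteq> 0" "W2 \<noteq> 0" "W3 \<noteq> 0" "W4 \<noteq> 0"
    unfolding W_eq by (rule frame_nonzero)+
  show h33: "G W3 W3 = h 3 3" by (simp add: W3_def h)
  then show p3: "0 < h 3 3" using pos[OF nonzero(3)] by simp
  have 23: "G W2 W3 = 0" "G W3 W2 = 0"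
    using p3 by (simp_all add: W2_def W3_def bil_simps h a_def)
  have Z2: "G (Z 1) W2 = h 1 2 + a * h 1 3" "G (Z 2) W2 = l2" "G (Z 4) W2 = h 2 4 + a * h 3 4"
    by (simp_all add: W2_def W3_def bil_simps h l2_def)
  have Z3: "G (Z 1) W3 = h 1 3" "G (Z 2) W3 = h 2 3" "G (Z 4) W3 = h 3 4"
    by (simp_all add: W3_def h)
  \<comment> \<open>The correction added to \<open>Z 2\<close> is orthogonal to \<open>W2\<close>,
    so the squared length equals \<open>G (Z 2) W2\<close>. The lengths of \<open>W1\<close> and
    \<open>W4\<close> are found in the same way.\<close>
  show W2: "G W2 W2 = l2"
    using bilinear_ladd[OF bil, of "Z 2" "a *\<^sub>R W3" W2] Z2 23 by (simp add: W2_def[symmetric] bil_simps(3))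
  then show p2: "0 < l2" using pos[OF nonzero(2)] by simp
  have W1_left: "G W1 v = G (Z 1) v + b2 * G W2 v + b3 * G W3 v" for v
    by (simp add: W1_def bil_simps)
  have 12: "G W1 W2 = 0" "G W2 W1 = 0"
    using p2 sym[of W2 W1] by (simp_all add: W1_left W2 Z2 23 b2_def)
  have 13: "G W1 W3 = 0" "G W3 W1 = 0"
    using p3 sym[of W3 W1] by (simp_all add: W1_left h33 Z3 23 b3_def)
  have Z1: "G (Z 1) W1 = l1" "G (Z 4) W1 = h 1 4 + b2 * (h 2 4 + a * h 3 4) + b3 * h 3 4"
    using Z2 Z3 by (simp_all add: W1_def bilinear_radd[OF bil] bilinear_rmul[OF bil] h l1_def)
  show W1: "G W1 W1 = l1"
    by (simp add: W1_left Z1 12 13)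
  then show p1: "0 < l1" using pos[OF nonzero(1)] by simp
  have W4_left: "G W4 v = G (Z 4) v + d1 * G W1 v + d2 * G W2 v + d3 * G W3 v" for v
    by (simp add: W4_def bil_simps)
  have 4: "G W4 W1 = 0" "G W4 W2 = 0" "G W4 W3 = 0"
    using p1 p2 p3 by (simp_all add: W4_left W1 W2 h33 12 13 23 Z1 Z2 Z3 d1_def d2_def d3_def)
  have "G (Z 4) W4 = l4"
    using Z1 Z2 Z3 by (simp add: W4_def bilinear_radd[OF bil] bilinear_rmul[OF bil] h l4_def)
  then show W4: "G W4 W4 = l4"
    using 4 sym[of _ W4] by (simp add: W4_left)
  then show "0 < l4" using pos[OF nonzero(4)] by simp
  show "diagonal_metric br X k a b2 (b2 * a + b3) (c1 + d1) (c2 + d1 * b2 + d2)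
     (c3 + d1 * (b2 * a + b3) + d2 * a + d3) W G"
  proof unfold_locales
    show "G (W i) (W j) = 0" if "i \<in> {1..4}" "j \<in> {1..4}" "i < j" for i j
      using that 12 13 23 4 sym[of _ W4] unfolding index_set by (auto simp: W_def)
  qed (use inner W_eq in \<open>simp_all add: W_def\<close>)
qed

text \<open>The frame \<open>Z\<close> is \<open>Y\<close> with \<open>a1 = a2 = a3 = 0\<close>. No
  diagonal solution is constructed for comparison; the off-diagonal components of the given flow are
  themselves shown to satisfy a linear differential inequality with zero initial values.\<close>

lemma ricci_flow_stays_diagonal:
  fixes c1 c2 c3 :: real
  defines "Z \<equiv> X(4 := X 4 + c1 *\<^sub>R X 1 + c2 *\<^sub>R X 2 + c3 *\<^sub>R X 3)"
  assumes flow: "ricci_flow br g0 T g"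
    and diag: "\<And>i j. \<lbrakk>i \<in> {1..4}; j \<in> {1..4}; i \<noteq> j\<rbrakk> \<Longrightarrow> g0 (Z i) (Z j) = 0"
    and t: "t \<in> forward_interval T" and ij: "i \<in> {1..4}" "j \<in> {1..4}" "i \<noteq> j"
  shows "g t (Z i) (Z j) = 0"
proof -
  \<comment> \<open>The estimates are made on the compact interval up to \<open>t\<close>, where
    continuous functions are bounded.\<close>
  have sub: "{0..t} \<subseteq> forward_interval T"
    using t by (auto simp: forward_interval_def intro: le_less_trans[of "ereal _" "ereal t"])
  have inner: "inner_product (g s)" if "s \<in> {0..t}" for s
    using flow sub that by (auto simp: ricci_flow_def)
  have deriv: "((\<lambda>s. g s u v) has_real_derivative - 2 * ricci br (g s) u v) (at s within {0..t})"
    if "s \<in> {0..t}" for s u v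
    using flow sub that unfolding ricci_flow_def by (blast intro: DERIV_subset[OF _ sub])
  define h where "h s = (\<lambda>i j. g s (Z i) (Z j))" for s
  have h_cont: "continuous_on {0..t} (\<lambda>s. h s i j)" for i j
    unfolding h_def by (rule DERIV_continuous_on) (rule deriv)
  \<comment> \<open>Gram-Schmidt data of \<open>g s\<close> as functions of time. The coefficients
    \<open>a\<close>, \<open>b2\<close>, \<open>b3\<close>, \<open>d1\<close>, \<open>d2\<close>,
    \<open>d3\<close> will be bounded by the off-diagonal components, while \<open>l1\<close>,
    \<open>l2\<close>, \<open>l4\<close> and \<open>h s 3 3\<close> are squared lengths and stay
    positive.\<close>
  define a where "a s = - h s 2 3 / h s 3 3" for s
  define l2 where "l2 s = h s 2 2 + a s * h s 2 3" for s
  define b2 where "b2 s = - (h s 1 2 + a s * h s 1 3) / l2 s" for s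
  define b3 where "b3 s = - h s 1 3 / h s 3 3" for s
  define l1 where "l1 s = h s 1 1 + b2 s * (h s 1 2 + a s * h s 1 3) + b3 s * h s 1 3" for s
  define d3 where "d3 s = - h s 3 4 / h s 3 3" for s
  define d2 where "d2 s = - (h s 2 4 + a s * h s 3 4) / l2 s" for s
  define d1 where "d1 s = - (h s 1 4 + b2 s * (h s 2 4 + a s * h s 3 4) + b3 s * h s 3 4) / l1 s" for s
  define l4 where "l4 s = h s 4 4 + d1 s * (h s 1 4 + b2 s * (h s 2 4 + a s * h s 3 4) + b3 s * h s 3 4)
    + d2 s * (h s 2 4 + a s * h s 3 4) + d3 s * h s 3 4" for s
  define W2 where "W2 s = Z 2 + a s *\<^sub>R Z 3" for s
  define W1 where "W1 s = Z 1 + b2 s *\<^sub>R W2 s + b3 s *\<^sub>R Z 3" for s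
  define W4 where "W4 s = Z 4 + d1 s *\<^sub>R W1 s + d2 s *\<^sub>R W2 s + d3 s *\<^sub>R Z 3" for s
  define W where "W s = (\<lambda>_::nat. 0)(1 := W1 s, 2 := W2 s, 3 := Z 3, 4 := W4 s)" for s
  have gs: "diagonal_metric br X k (a s) (b2 s) (b2 s * a s + b3 s) (c1 + d1 s) (c2 + d1 s * b2 s + d2 s)
     (c3 + d1 s * (b2 s * a s + b3 s) + d2 s * a s + d3 s) (W s) (g s)"
    "g s (W1 s) (W1 s) = l1 s" "g s (W2 s) (W2 s) = l2 s" "g s (Z 3) (Z 3) = h s 3 3"
    "g s (W4 s) (W4 s) = l4 s" "0 < l1 s" "0 < l2 s" "0 < h s 3 3" "0 < l4 s"
    if s: "s \<in> {0..t}" for s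
    by (rule diagonal_metric_gram_schmidt[OF inner[OF s], OF Z_def[THEN meta_eq_to_obj_eq],
      OF h_def, OF a_def, OF l2_def, OF b2_def, OF b3_def, OF l1_def, OF d3_def, OF d2_def,
      OF d1_def, OF l4_def, OF refl, OF W2_def, OF W1_def, OF W4_def, OF W_def])+
  have gs_pos: "h s 3 3 \<noteq> 0" "l1 s \<noteq> 0" "l2 s \<noteq> 0" "l4 s \<noteq> 0" if "s \<in> {0..t}" for s
    using gs(6-9)[OF that] by auto

  \<comment> \<open>Every summand of a quantity that is to be shown \<open>O(S)\<close> below has its small factor leftmost,
    which is the shape required by \<open>bigo_mult_continuous\<close>.\<close>
  define rho where "rho s = (b2 s * a s + b3 s) * (b2 s - 3 * k) - a s * (1 + (b2 s)\<^sup>2)" for s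
  define om where "om s = (b2 s * a s + b3 s) - a s * (b2 s + 3 * k)" for s
  define r11 where "r11 s = ((l1 s)\<^sup>2 / l2 s - (1 + (b2 s)\<^sup>2)\<^sup>2 * l2 s - (rho s)\<^sup>2 * h s 3 3) / (2 * l4 s)" for s
  define r22 where "r22 s = ((1 + (b2 s)\<^sup>2)\<^sup>2 * (l2 s)\<^sup>2 / l1 s - l1 s - (om s)\<^sup>2 * h s 3 3) / (2 * l4 s)" for s
  define r33 where "r33 s = ((rho s)\<^sup>2 * (h s 3 3)\<^sup>2 / l1 s + (om s)\<^sup>2 * (h s 3 3)\<^sup>2 / l2 s) / (2 * l4 s)" for s
  define r12 where "r12 s = (b2 s * (- 2 * ((1 + (b2 s)\<^sup>2) * l2 s + l1 s)) - rho s * om s * h s 3 3) / (2 * l4 s)" for s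
  define r13 where "r13 s = (rho s * ((3 * k - b2 s) * h s 3 3) - om s * (h s 3 3 * l1 s / l2 s)) / (2 * l4 s)" for s
  define r23 where "r23 s = (rho s * ((1 + (b2 s)\<^sup>2) * h s 3 3 * l2 s / l1 s) + om s * ((3 * k + b2 s) * h s 3 3)) / (2 * l4 s)" for s
  have W: "W s 1 = W1 s" "W s 2 = W2 s" "W s 3 = Z 3" "W s 4 = W4 s" for s
    by (simp_all add: W_def)
  have r: "ricci br (g s) (W1 s) (W1 s) = r11 s" "ricci br (g s) (W2 s) (W2 s) = r22 s"
      "ricci br (g s) (Z 3) (Z 3) = r33 s"
      "ricci br (g s) (W1 s) (W2 s) = r12 s" "ricci br (g s) (W1 s) (Z 3) = r13 s"
      "ricci br (g s) (W2 s) (Z 3) = r23 s"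
      "ricci br (g s) (W2 s) (W1 s) = r12 s" "ricci br (g s) (Z 3) (W1 s) = r13 s"
      "ricci br (g s) (Z 3) (W2 s) = r23 s"
      "ricci br (g s) (W1 s) (W4 s) = 0" "ricci br (g s) (W2 s) (W4 s) = 0"
      "ricci br (g s) (Z 3) (W4 s) = 0"
      if s: "s \<in> {0..t}" for s
  proof -
    interpret m: diagonal_metric br X k "a s" "b2 s" "b2 s * a s + b3 s" "c1 + d1 s"
      "c2 + d1 s * b2 s + d2 s" "c3 + d1 s * (b2 s * a s + b3 s) + d2 s * a s + d3 s" "W s" "g s"
      by (rule gs(1)[OF s])
    have eqs: "m.\<rho> = rho s" "m.\<omega> = om s"
      by (simp_all add: m.\<rho>_def m.\<omega>_def rho_def om_def)
    note q = gs(2-5)[OF s]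
    show "ricci br (g s) (W1 s) (W1 s) = r11 s" "ricci br (g s) (W2 s) (W2 s) = r22 s"
      "ricci br (g s) (Z 3) (Z 3) = r33 s"
      using m.ricci_diagonal unfolding W q eqs r11_def r22_def r33_def by simp_all
    show r: "ricci br (g s) (W1 s) (W2 s) = r12 s" "ricci br (g s) (W1 s) (Z 3) = r13 s"
      "ricci br (g s) (W2 s) (Z 3) = r23 s"
      using m.ricci_off_diagonal unfolding W q eqs r12_def r13_def r23_def by (simp_all add: algebra_simps)
    show "ricci br (g s) (W2 s) (W1 s) = r12 s" "ricci br (g s) (Z 3) (W1 s) = r13 s"
      "ricci br (g s) (Z 3) (W2 s) = r23 s"
      using r m.ricci_sym[of 1 2] m.ricci_sym[of 1 3] m.ricci_sym[of 2 3] unfolding W by auto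
    show "ricci br (g s) (W1 s) (W4 s) = 0" "ricci br (g s) (W2 s) (W4 s) = 0"
      "ricci br (g s) (Z 3) (W4 s) = 0"
      using m.ricci_Jn[of 1] m.ricci_Jn[of 2] m.ricci_Jn[of 3] unfolding W by auto
  qed

  \<comment> \<open>Because \<open>W4 s\<close> has no Ricci component with the ideal,
    \<open>- u1 s\<close>, \<open>- u2 s\<close>, \<open>- u3 s\<close> are the Ricci components of
    \<open>Z 4\<close> with \<open>W1 s\<close>, \<open>W2 s\<close>, \<open>Z 3\<close>. They are
    small through \<open>d1\<close>, \<open>d2\<close>, \<open>d3\<close>, although
    \<open>r11\<close>, \<open>r22\<close>, \<open>r33\<close> need not be.\<close>
  define u1 where "u1 s = d1 s * r11 s + d2 s * r12 s + d3 s * r13 s" for s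
  define u2 where "u2 s = d1 s * r12 s + d2 s * r22 s + d3 s * r23 s" for s
  define u3 where "u3 s = d1 s * r13 s + d2 s * r23 s + d3 s * r33 s" for s
  define P :: "(nat \<times> nat) set" where "P = {(1, 2), (1, 3), (2, 3), (1, 4), (2, 4), (3, 4)}"
  \<comment> \<open>Ricci components in the fixed frame, found by inverting the triangular change of
    frame. Every summand contains a small factor: an off-diagonal \<open>r\<close>, some
    \<open>u\<close>, or a Gram-Schmidt coefficient. Outside \<open>P\<close> the value 0 is a mere
    default.\<close>
  define ric :: "nat \<times> nat \<Rightarrow> real \<Rightarrow> real" where "ric = (\<lambda>_ _. 0)
    ((1, 2) := \<lambda>s. r12 s - a s * r13 s - b2 s * (r22 s - a s * r23 s) - b3 s * (r23 s - a s * r33 s),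
     (1, 3) := \<lambda>s. r13 s - b2 s * r23 s - b3 s * r33 s,
     (2, 3) := \<lambda>s. r23 s - a s * r33 s,
     (1, 4) := \<lambda>s. u2 s * b2 s + u3 s * b3 s - u1 s,
     (2, 4) := \<lambda>s. u3 s * a s - u2 s,
     (3, 4) := \<lambda>s. - u3 s)"
  have ric: "ricci br (g s) (Z (fst p)) (Z (snd p)) = ric p s" if s: "s \<in> {0..t}" and p: "p \<in> P" for s p
  proof -
    interpret m: diagonal_metric br X k "a s" "b2 s" "b2 s * a s + b3 s" "c1 + d1 s"
      "c2 + d1 s * b2 s + d2 s" "c3 + d1 s * (b2 s * a s + b3 s) + d2 s * a s + d3 s" "W s" "g s"
      by (rule gs(1)[OF s])
    note bil = m.bilinear_ricci
    note bil_simps = bilinear_ladd[OF bil] bilinear_radd[OF bil] bilinear_lmul[OF bil] bilinear_rmul[OF bil]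
      bilinear_lsub[OF bil] bilinear_rsub[OF bil]
    have Z2: "Z 2 = W2 s - a s *\<^sub>R Z 3" by (simp add: W2_def)
    have Z1: "Z 1 = W1 s - b2 s *\<^sub>R W2 s - b3 s *\<^sub>R Z 3" by (simp add: W1_def)
    have Z4: "Z 4 = W4 s - d1 s *\<^sub>R W1 s - d2 s *\<^sub>R W2 s - d3 s *\<^sub>R Z 3" by (simp add: W4_def)
    show ?thesis
      using p unfolding P_def
      by (auto simp: Z1 Z2 Z4 bil_simps r[OF s] ric_def u1_def u2_def u3_def algebra_simps)
  qed

  have ac: "continuous_on {0..t} a"
    unfolding a_def by (intro continuous_intros h_cont) (use gs_pos in auto)
  have l2c: "continuous_on {0..t} l2"
    unfolding l2_def by (intro continuous_intros h_cont ac)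
  have bc: "continuous_on {0..t} b2" "continuous_on {0..t} b3"
    unfolding b2_def b3_def by (intro continuous_intros h_cont ac l2c; use gs_pos in auto)+
  have l1c: "continuous_on {0..t} l1"
    unfolding l1_def by (intro continuous_intros h_cont ac bc)
  have dc: "continuous_on {0..t} d1" "continuous_on {0..t} d2" "continuous_on {0..t} d3"
    unfolding d1_def d2_def d3_def by (intro continuous_intros h_cont ac bc l1c l2c; use gs_pos in auto)+
  have l4c: "continuous_on {0..t} l4"
    unfolding l4_def by (intro continuous_intros h_cont ac bc dc)
  have rhoc: "continuous_on {0..t} rho" "continuous_on {0..t} om"
    unfolding rho_def om_def by (intro continuous_intros ac bc)+
  have rc: "continuous_on {0..t} r11" "continuous_on {0..t} r22" "continuous_on {0..t} r33"
     "continuous_on {0..t} r12" "continuous_on {0..t} r13" "continuous_on {0..t} r23"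
    unfolding r11_def r22_def r33_def r12_def r13_def r23_def
    by (intro continuous_intros h_cont ac bc l1c l2c l4c rhoc; use gs_pos in auto)+
  note cont = continuous_intros h_cont ac bc dc l1c l2c l4c rhoc rc

  \<comment> \<open>\<open>S\<close> is the sum on the right-hand side of the Gronwall bound, so
    membership in \<open>O[principal {0..t}](S)\<close> is the smallness that
    \<open>linear_system_unique_zero\<close> asks for.\<close>
  define S where "S s = (\<Sum>p\<in>P. \<bar>h s (fst p) (snd p)\<bar>)" for s
  have hS: "(\<lambda>s. h s (fst p) (snd p)) \<in> O[principal {0..t}](S)" if "p \<in> P" for p
  proof (rule bigoI[of _ 1])
    have "finite P" by (simp add: P_def)
    then show "\<forall>\<^sub>F s in principal {0..t}. norm (h s (fst p) (snd p)) \<le> 1 * norm (S s)"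
      using member_le_sum[OF that, of "\<lambda>p. \<bar>h _ (fst p) (snd p)\<bar>"]
      by (simp add: eventually_principal S_def abs_of_nonneg sum_nonneg)
  qed
  have hS: "(\<lambda>s. h s 1 2) \<in> O[principal {0..t}](S)" "(\<lambda>s. h s 1 3) \<in> O[principal {0..t}](S)"
    "(\<lambda>s. h s 2 3) \<in> O[principal {0..t}](S)" "(\<lambda>s. h s 1 4) \<in> O[principal {0..t}](S)"
    "(\<lambda>s. h s 2 4) \<in> O[principal {0..t}](S)" "(\<lambda>s. h s 3 4) \<in> O[principal {0..t}](S)"
    using hS[of "(1, 2)"] hS[of "(1, 3)"] hS[of "(2, 3)"] hS[of "(1, 4)"] hS[of "(2, 4)"] hS[of "(3, 4)"]
    by (simp_all add: P_def)
  have neg: "(\<lambda>s. - f s) \<in> O[principal {0..t}](S)" if "f \<in> O[principal {0..t}](S)" for f :: "real \<Rightarrow> real"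
    using that by simp
  note bigo = sum_in_bigo bigo_mult_continuous bigo_divide_continuous neg
  have aS: "a \<in> O[principal {0..t}](S)"
    unfolding a_def by (intro bigo hS cont) (use gs_pos in auto)
  have "(\<lambda>s. h s 1 2 + h s 1 3 * a s) \<in> O[principal {0..t}](S)" "(\<lambda>s. h s 2 4 + h s 3 4 * a s) \<in> O[principal {0..t}](S)"
    by (intro bigo hS cont)+
  then have h': "(\<lambda>s. h s 1 2 + a s * h s 1 3) \<in> O[principal {0..t}](S)" "(\<lambda>s. h s 2 4 + a s * h s 3 4) \<in> O[principal {0..t}](S)"
    by (simp_all add: mult.commute)
  have bS: "b2 \<in> O[principal {0..t}](S)" "b3 \<in> O[principal {0..t}](S)"
    unfolding b2_def b3_def by (intro bigo hS h' cont; use gs_pos in auto)+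
  have dS: "d1 \<in> O[principal {0..t}](S)" "d2 \<in> O[principal {0..t}](S)" "d3 \<in> O[principal {0..t}](S)"
    unfolding d1_def d2_def d3_def by (intro bigo hS h' bS cont; use gs_pos in auto)+
  have rhoS: "rho \<in> O[principal {0..t}](S)" "om \<in> O[principal {0..t}](S)"
    unfolding rho_def om_def by (intro bigo aS bS cont)+
  have rS: "r12 \<in> O[principal {0..t}](S)" "r13 \<in> O[principal {0..t}](S)" "r23 \<in> O[principal {0..t}](S)"
    unfolding r12_def r13_def r23_def
    by (intro bigo rhoS bS cont; use gs_pos in auto)+
  have uS: "u1 \<in> O[principal {0..t}](S)" "u2 \<in> O[principal {0..t}](S)" "u3 \<in> O[principal {0..t}](S)"
    unfolding u1_def u2_def u3_def by (intro bigo dS cont)+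
  have ricS: "ric p \<in> O[principal {0..t}](S)" if "p \<in> P" for p
    using that unfolding P_def ric_def
    by (auto intro!: bigo rS aS bS uS cont)

  have zero: "h t (fst p) (snd p) = 0" if "p \<in> P" for p
  proof (rule linear_system_unique_zero[where A = P and b = t and t = t and i = p
        and x = "\<lambda>p s. h s (fst p) (snd p)" and x' = "\<lambda>p s. - 2 * ric p s"])
    show "finite P" by (simp add: P_def)
    show "p \<in> P" by fact
    show "t \<in> {0..t}" using t by (simp add: forward_interval_def)
    show "((\<lambda>s. h s (fst p) (snd p)) has_real_derivative - 2 * ric p s) (at s within {0..t})"
      if "p \<in> P" "s \<in> {0..t}" for p s
      using deriv[OF that(2)] ric[OF that(2,1)] unfolding h_def by metis
    show "h 0 (fst p) (snd p) = 0" if "p \<in> P" for p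
      using flow that diag unfolding h_def P_def ricci_flow_def by auto
    show "(\<lambda>s. - 2 * ric p s) \<in> O[principal {0..t}](\<lambda>s. \<Sum>p\<in>P. \<bar>h s (fst p) (snd p)\<bar>)"
      if "p \<in> P" for p
      using ricS[OF that] unfolding S_def by simp
  qed
  have sym: "h t i j = h t j i"
    unfolding h_def using inner_productD(2)[OF inner[of t]] t by (simp add: forward_interval_def)
  have "(i, j) \<in> P \<or> (j, i) \<in> P"
    using ij unfolding index_set P_def by auto
  then show ?thesis
    using zero[of "(i, j)"] zero[of "(j, i)"] sym unfolding h_def by auto
qed

end

section \<open>Initial Ricci components of a flow that stays diagonal, and the equivalence\<close>

lemma ricci_eq_0_if_flow_stationary:
  assumes flow: "ricci_flow br g0 T g"
    and const: "\<And>t. t \<in> forward_interval T \<Longrightarrow> g t u v = 0"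
  shows "ricci br g0 u v = 0"
proof -
  from flow have T: "0 < T" and init: "g 0 = g0"
    and deriv: "\<And>t. t \<in> forward_interval T \<Longrightarrow>
      ((\<lambda>s. g s u v) has_real_derivative - 2 * ricci br (g t) u v) (at t within forward_interval T)"
    by (auto simp: ricci_flow_def)
  \<comment> \<open>\<open>T\<close> may be infinite, so a finite \<open>b\<close> below it is
    chosen. In \<open>{0..b}\<close> the point 0 is a limit point, which makes the one-sided
    derivative there unique.\<close>
  obtain b where b: "0 < b" "ereal b < T"
    using ereal_dense2[OF T] by auto
  have sub: "{0..b} \<subseteq> forward_interval T"
    using b by (auto simp: forward_interval_def intro: le_less_trans[of "ereal _" "ereal b"])
  have "((\<lambda>s. g s u v) has_real_derivative - 2 * ricci br g0 u v) (at 0 within {0..b})"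
    using DERIV_subset[OF deriv sub, of 0] T init by (simp add: forward_interval_def zero_ereal_def)
  moreover have "((\<lambda>s. g s u v) has_real_derivative 0) (at 0 within {0..b})"
    by (rule has_field_derivative_transform_within[where f = "\<lambda>_. 0" and d = 1])
      (use b sub const in auto)
  moreover have "at 0 within {0..b} \<noteq> bot"
    using b by (simp add: at_within_Icc_at_right)
  ultimately have "- 2 * ricci br g0 u v = 0"
    by (rule has_field_derivative_unique)
  then show ?thesis by simp
qed

theorem proposition2:
  fixes br :: "'g::real_vector \<Rightarrow> 'g \<Rightarrow> 'g"
    and X Y :: "nat \<Rightarrow> 'g"
    and k a1 a2 a3 a4 a5 a6 :: real
    and l :: "nat \<Rightarrow> real"
    and g0 :: "'g \<Rightarrow> 'g \<Rightarrow> real"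
    and g :: "real \<Rightarrow> 'g \<Rightarrow> 'g \<Rightarrow> real"
    and T :: ereal
  assumes "lie_algebra br"
    and "inj_on X {1..4}" and "is_basis (X ` {1..4})"
    and "br (X 2) (X 3) = 0" and "br (X 3) (X 1) = 0" and "br (X 1) (X 2) = 0"
    and "br (X 1) (X 4) = k *\<^sub>R X 1 + X 2"
    and "br (X 2) (X 4) = - X 1 + k *\<^sub>R X 2"
    and "br (X 3) (X 4) = (- 2 * k) *\<^sub>R X 3"
    and "Y 1 = X 1 + a2 *\<^sub>R X 2 + a3 *\<^sub>R X 3"
    and "Y 2 = X 2 + a1 *\<^sub>R X 3"
    and "Y 3 = X 3"
    and "Y 4 = a4 *\<^sub>R X 1 + a5 *\<^sub>R X 2 + a6 *\<^sub>R X 3 + X 4"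
    and "inner_product g0"
    and "\<And>i. i \<in> {1..4} \<Longrightarrow> l i > 0"
    and "\<And>i j. i \<in> {1..4} \<Longrightarrow> j \<in> {1..4} \<Longrightarrow> g0 (Y i) (Y j) = (if i = j then l i else 0)"
    and "maximal_ricci_flow br g0 T g"
  shows "(\<forall>t\<in>forward_interval T. \<forall>i\<in>{1..4}. \<forall>j\<in>{1..4}. i \<noteq> j \<longrightarrow> g t (Y i) (Y j) = 0)
         \<longleftrightarrow> a1 = 0 \<and> a2 = 0 \<and> a3 = 0"
proof -
  interpret solvable_lie_algebra br X k
    using assms(1-9) by unfold_locales
  have flow: "ricci_flow br g0 T g"
    using assms(17) by (simp add: maximal_ricci_flow_def)
  \<comment> \<open>The given frame fits the locale, with \<open>a4\<close>, \<open>a5\<close>,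
    \<open>a6\<close> in the role of \<open>c1\<close>, \<open>c2\<close>,
    \<open>c3\<close>.\<close>
  interpret Y: diagonal_metric br X k a1 a2 a3 a4 a5 a6 Y g0
    by unfold_locales (use assms(10-14,16) in \<open>auto simp: algebra_simps\<close>)
  show ?thesis
  proof
    assume diag: "\<forall>t\<in>forward_interval T. \<forall>i\<in>{1..4}. \<forall>j\<in>{1..4}. i \<noteq> j \<longrightarrow> g t (Y i) (Y j) = 0"
    have "ricci br g0 (Y i) (Y j) = 0" if "i \<in> {1..4}" "j \<in> {1..4}" "i \<noteq> j" for i j
      using diag that by (intro ricci_eq_0_if_flow_stationary[OF flow]) auto
    then show "a1 = 0 \<and> a2 = 0 \<and> a3 = 0"
      by (intro Y.ricci_diagonal_imp) auto
  next
    assume a: "a1 = 0 \<and> a2 = 0 \<and> a3 = 0"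
    \<comment> \<open>With \<open>a1\<close>, \<open>a2\<close>, \<open>a3\<close> zero this agrees
      with \<open>Y\<close> at the indices 1 to 4, the only ones at which \<open>Y\<close> is
      specified.\<close>
    let ?Z = "X(4 := X 4 + a4 *\<^sub>R X 1 + a5 *\<^sub>R X 2 + a6 *\<^sub>R X 3)"
    have Y: "?Z i = Y i" if "i \<in> {1..4}" for i
      using that a assms(10-13) unfolding index_set by (auto simp: algebra_simps)
    have "g t (?Z i) (?Z j) = 0"
      if "t \<in> forward_interval T" "i \<in> {1..4}" "j \<in> {1..4}" "i \<noteq> j" for t i j
      by (rule ricci_flow_stays_diagonal[OF flow _ that]) (simp only: Y assms(16) if_False)
    then show "\<forall>t\<in>forward_interval T. \<forall>i\<in>{1..4}. \<forall>j\<in>{1..4}. i \<noteq> j \<longrightarrow> g t (Y i) (Y j) = 0"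
      by (simp only: Y) blast
  qed
qed

end
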